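(* Let $\{M_0(t)\}_{t\ge0}$ and $\{M(t)\}_{t\ge0}$ be independent generalized counting processes with positive rates $\mu_1,\dots,\mu_{k_0}$ and $\lambda_1,\dots,\lambda_k$, respectively, and let $X_1,X_2,\dots$ be i.i.d. real random variables, independent of $M$ and $M_0$, with distribution function $H_X$. Let $\lambda=\sum_{j=1}^k\lambda_j$, $\mu=\sum_{j_0=1}^{k_0}\mu_{j_0}$ and $Z(t)=\sum_{i=1}^{M(M_0(t))}X_i$, $t\ge0$. Then the distribution function $\hat H(w,t)=\mathrm{Pr}\{Z(t)\le w\}$ is given by $$\hat H(w,t)=\mathbb{I}_{\{w\ge0\}}\exp\Big(-\sum_{j_0=1}^{k_0}\mu_{j_0}t(1-e^{-j_0\lambda})\Big)+\sum_{m=1}^{\infty}H_X^{*(m)}(w)\sum_{\Omega(k,m)}\Big(\prod_{j=1}^{k}\frac{\lambda_j^{m_j}}{m_j!}\Big)e^{-\mu t}\sum_{\sum_{j_0=1}^{k_0}r_{j_0}=z_k}z_k!\prod_{j_0=1}^{k_0}\frac{j_0^{r_{j_0}}}{r_{j_0}!}e^{\mu_{j_0}te^{-j_0\lambda}}\mathcal{B}_{r_{j_0}}\big(e^{-j_0\lambda}\mu_{j_0}t\big),$$ where the sum over $\Omega(k,m)$ runs over $(m_1,\dots,m_k)\in\Omega(k,m)$, $z_k=m_1+\dots+m_k$, the innermost sum is over non-negative integers $r_1,\dots,r_{k_0}$ with sum $z_k$, and $H_X^{*(m)}$ is the $m$-fold convolution of $H_X$ (the distribution function of $X_1+\dots+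X_m$).
   Context: A generalized counting process (GCP) $\{M(t)\}_{t\ge0}$ with positive rates $\lambda_1,\dots,\lambda_k$ is a right-continuous $\mathbb{N}_0$-valued process with $M(0)=0$ and stationary independent increments, whose probability generating function is $\mathbb{E}(u^{M(t)})=\exp\big(-t\sum_{j=1}^{k}\lambda_j(1-u^j)\big)$, $|u|\le1$. The process $Z$ is called the compound iterated generalized counting process (compound IGCP). $\Omega(k,m)=\{(m_1,\dots,m_k)\in\mathbb{N}_0^k: m_1+2m_2+\dots+km_k=m\}$. The Bell polynomial of order $n\ge0$ is $\mathcal{B}_n(x)=e^{-x}\sum_{r=0}^{\infty}\frac{r^n x^r}{r!}$, with $0^0=1$. $\mathbb{I}$ denotes an indicator. *)

theory Defs
  imports "HOL-Probability.Probability"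
begin

text \<open>
  Processes indexed by \<open>t \<ge> 0\<close> are functions on all reals of which only the values at
  nonnegative times matter. Rates are indexed by \<open>{1..k}\<close>. The path properties
  (right-continuity, start in 0) are only required almost surely. Increments are taken in the
  integers, since subtraction on \<open>nat\<close> truncates and monotonicity of the paths is not assumed.
\<close>

definition stationary_increments :: "'a measure \<Rightarrow> (real \<Rightarrow> 'a \<Rightarrow> nat) \<Rightarrow> bool" where
  "stationary_increments P N \<longleftrightarrow>
     (\<forall>s\<ge>0. \<forall>t\<ge>0. \<forall>h\<ge>0.
        distr P (count_space UNIV) (\<lambda>\<omega>. int (N (s + h) \<omega>) - int (N s \<omega>)) =
        distr P (count_space UNIV) (\<lambda>\<omega>. int (N (t + h) \<omega>) - int (N t \<omega>)))"

definition independent_increments :: "'a measure \<Rightarrow> (real \<Rightarrow> 'a \<Rightarrow> nat) \<Rightarrow> bool" where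
  "independent_increments P N \<longleftrightarrow>
     (\<forall>(n::nat) (t :: nat \<Rightarrow> real). 0 \<le> t 0 \<and> (\<forall>i<n. t i < t (Suc i)) \<longrightarrow>
        prob_space.indep_vars P (\<lambda>_. count_space UNIV)
          (\<lambda>i \<omega>. int (N (t (Suc i)) \<omega>) - int (N (t i) \<omega>)) {..<n})"

definition generalized_counting_process ::
    "'a measure \<Rightarrow> nat \<Rightarrow> (nat \<Rightarrow> real) \<Rightarrow> (real \<Rightarrow> 'a \<Rightarrow> nat) \<Rightarrow> bool" where
  "generalized_counting_process P k l N \<longleftrightarrow>
     1 \<le> k \<and> (\<forall>j\<in>{1..k}. 0 < l j) \<and>
     (\<forall>t\<ge>0. N t \<in> measurable P (count_space UNIV)) \<and>
     (AE \<omega> in P. \<forall>t\<ge>0. continuous (at_right t) (\<lambda>s. N s \<omega>)) \<and>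
     (AE \<omega> in P. N 0 \<omega> = 0) \<and>
     stationary_increments P N \<and>
     independent_increments P N \<and>
     (\<forall>t\<ge>0. \<forall>u::real. \<bar>u\<bar> \<le> 1 \<longrightarrow>
        integral\<^sup>L P (\<lambda>\<omega>. u ^ N t \<omega>) = exp (- t * (\<Sum>j=1..k. l j * (1 - u ^ j))))"

definition process_space :: "(real \<Rightarrow> nat) measure" where
  "process_space = (\<Pi>\<^sub>M t\<in>{0..}. count_space UNIV)"

definition whole_path :: "(real \<Rightarrow> 'a \<Rightarrow> nat) \<Rightarrow> 'a \<Rightarrow> (real \<Rightarrow> nat)" where
  "whole_path N \<omega> = (\<lambda>t\<in>{0..}. N t \<omega>)"

text \<open>
  The variables are \<open>X 1, X 2, \<dots>\<close>; \<open>X 0\<close> plays no role.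
\<close>

definition iid_with_cdf :: "'a measure \<Rightarrow> (nat \<Rightarrow> 'a \<Rightarrow> real) \<Rightarrow> (real \<Rightarrow> real) \<Rightarrow> bool" where
  "iid_with_cdf P X H \<longleftrightarrow>
     prob_space.indep_vars P (\<lambda>_. borel) X {1..} \<and>
     (\<forall>i\<ge>1. cdf (distr P borel (X i)) = H)"

definition compound_igcp ::
    "(real \<Rightarrow> 'a \<Rightarrow> nat) \<Rightarrow> (real \<Rightarrow> 'a \<Rightarrow> nat) \<Rightarrow> (nat \<Rightarrow> 'a \<Rightarrow> real) \<Rightarrow> real \<Rightarrow> 'a \<Rightarrow> real" where
  "compound_igcp M0 M X t \<omega> = (\<Sum>i=1..M (real (M0 t \<omega>)) \<omega>. X i \<omega>)"

primrec convolution_power :: "nat \<Rightarrow> real measure \<Rightarrow> real measure" where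
  "convolution_power 0 D = return borel 0"
| "convolution_power (Suc m) D = (D \<star> convolution_power m D)"

text \<open>
  The \<open>m\<close>-fold convolution of a distribution function: the distribution function of the
  \<open>m\<close>-fold convolution of its Lebesgue--Stieltjes measure.
\<close>

definition cdf_convolution_power :: "nat \<Rightarrow> (real \<Rightarrow> real) \<Rightarrow> real \<Rightarrow> real" where
  "cdf_convolution_power m H = cdf (convolution_power m (interval_measure H))"

definition Omega :: "nat \<Rightarrow> nat \<Rightarrow> (nat \<Rightarrow> nat) set" where
  "Omega k m = {ms \<in> {1..k} \<rightarrow>\<^sub>E UNIV. (\<Sum>j=1..k. j * ms j) = m}"

definition compositions :: "nat \<Rightarrow> nat \<Rightarrow> (nat \<Rightarrow> nat) set" where
  "compositions k z = {r \<in> {1..k} \<rightarrow>\<^sub>E UNIV. (\<Sum>j=1..k. r j) = z}"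

definition bell_polynomial :: "nat \<Rightarrow> real \<Rightarrow> real" where
  "bell_polynomial n x = exp (- x) * (\<Sum>r. real r ^ n * x ^ r / fact r)"

end

theory Submission
  imports Defs
begin

text \<open>
  Conditioning on the value of \<open>M (M0 t)\<close>, which is independent of the \<open>X i\<close>, gives
  \<open>Pr (Z t \<le> w) = (\<Sum>m. Pr (M (M0 t) = m) * H\<^sup>*\<^sup>m w)\<close>. Expanding the probability generating function
  as a power series gives \<open>Pr (M s = m)\<close> as a sum over \<open>Omega k m\<close> in which \<open>s\<close> enters only through
  \<open>s ^ z * exp (- s * lams)\<close>. What remains is the exponentially tilted moment
  \<open>E (M0 t ^ z * exp (- M0 t * lams))\<close>, where \<open>M0 t\<close> is distributed as \<open>\<Sum>j. j * N j\<close> with independent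
  Poisson variables \<open>N j\<close> of means \<open>mu j * t\<close>; its multinomial expansion consists of products of tilted
  Poisson moments, which are the Bell polynomials.
\<close>

section \<open>Products of series as series over function spaces\<close>

text \<open>Induction on \<open>A\<close>: a function on \<open>insert a A\<close> amounts to its
  value at \<open>a\<close> and a function on \<open>A\<close>. Nonnegativity lets convergence of
  the iterated sum imply summability over the pairs.\<close>

lemma has_sum_prod_PiE_nonneg:
  fixes f :: "'i \<Rightarrow> 'b \<Rightarrow> real"
  assumes "finite A" and "\<And>i. i \<in> A \<Longrightarrow> (f i has_sum s i) (B i)"
    and "\<And>i y. i \<in> A \<Longrightarrow> y \<in> B i \<Longrightarrow> 0 \<le> f i y"
  shows "((\<lambda>g. \<Prod>i\<in>A. f i (g i)) has_sum (\<Prod>i\<in>A. s i)) (PiE A B)"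
  using assms
proof (induction A)
  case empty
  \<comment> \<open>\<open>PiE {} B\<close> contains only the everywhere undefined function, and the
    empty product is 1.\<close>
  have "((\<lambda>g. 1) has_sum (\<Sum>g\<in>{\<lambda>x. undefined}. 1::real)) {\<lambda>x::'i. undefined::'b}"
    using has_sum_finite[of "{\<lambda>x::'i. undefined::'b}" "\<lambda>_. 1::real"] by simp
  then show ?case by simp
next
  case (insert a A)
  let ?F = "\<lambda>(y, g). f a y * (\<Prod>i\<in>A. f i (g i))"
  have IH: "((\<lambda>g. \<Prod>i\<in>A. f i (g i)) has_sum (\<Prod>i\<in>A. s i)) (PiE A B)"
    by (rule insert.IH) (use insert.prems in auto)
  have inner: "((\<lambda>g. ?F (y, g)) has_sum f a y * (\<Prod>i\<in>A. s i)) (PiE A B)" for y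
    using has_sum_cmult_right[OF IH] by simp
  have outer: "((\<lambda>y. f a y * (\<Prod>i\<in>A. s i)) has_sum s a * (\<Prod>i\<in>A. s i)) (B a)"
    using insert.prems by (intro has_sum_cmult_left) auto
  have nonneg: "0 \<le> ?F (y, g)" if "y \<in> B a" "g \<in> PiE A B" for y g
    using that insert.prems by (auto intro!: mult_nonneg_nonneg prod_nonneg)
  have "?F summable_on Sigma (B a) (\<lambda>_. PiE A B)"
    by (rule summable_on_SigmaI[OF inner _ nonneg]) (use outer in \<open>auto simp: summable_on_def\<close>)
  with inner outer have sum: "(?F has_sum s a * (\<Prod>i\<in>A. s i)) (B a \<times> PiE A B)"
    by (intro has_sum_SigmaI)
  have "?F = (\<lambda>g. \<Prod>i\<in>insert a A. f i (g i)) \<circ> (\<lambda>(y, g). g(a := y))"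
    using insert.hyps by (auto simp: fun_eq_iff intro!: prod.cong)
  with sum have "((\<lambda>g. \<Prod>i\<in>insert a A. f i (g i)) has_sum s a * (\<Prod>i\<in>A. s i))
      ((\<lambda>(y, g). g(a := y)) ` (B a \<times> PiE A B))"
    by (subst has_sum_reindex) (use insert.hyps inj_combinator[of a A B] in \<open>auto\<close>)
  then show ?case
    using insert.hyps by (simp add: PiE_insert_eq)
qed

text \<open>The nonnegative case, applied to the norms, supplies absolute summability; the value
  then comes from the product formula for \<open>infsum\<close>, which by itself does not assert
  convergence.\<close>

lemma has_sum_prod_PiE_abs:
  fixes f :: "'i \<Rightarrow> 'b \<Rightarrow> real"
  assumes "finite A" and "\<And>i. i \<in> A \<Longrightarrow> (f i has_sum s i) (B i)"
    and "\<And>i. i \<in> A \<Longrightarrow> (\<lambda>y. norm (f i y)) summable_on B i"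
  shows "((\<lambda>g. \<Prod>i\<in>A. f i (g i)) has_sum (\<Prod>i\<in>A. s i)) (PiE A B)"
proof -
  have "((\<lambda>g. \<Prod>i\<in>A. norm (f i (g i))) has_sum (\<Prod>i\<in>A. \<Sum>\<^sub>\<infinity>y\<in>B i. norm (f i y))) (PiE A B)"
    by (rule has_sum_prod_PiE_nonneg[OF assms(1)]) (use assms(3) has_sum_infsum in auto)
  then have "(\<lambda>g. norm (\<Prod>i\<in>A. f i (g i))) summable_on PiE A B"
    unfolding prod_norm by (rule has_sum_imp_summable)
  then have "(\<lambda>g. \<Prod>i\<in>A. f i (g i)) summable_on PiE A B"
    by (rule abs_summable_summable)
  then have "((\<lambda>g. \<Prod>i\<in>A. f i (g i)) has_sum (\<Sum>\<^sub>\<infinity>g\<in>PiE A B. \<Prod>i\<in>A. f i (g i))) (PiE A B)"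
    by (rule has_sum_infsum)
  also have "(\<Sum>\<^sub>\<infinity>g\<in>PiE A B. \<Prod>i\<in>A. f i (g i)) = (\<Prod>i\<in>A. \<Sum>\<^sub>\<infinity>y\<in>B i. f i y)"
    by (rule infsum_prod_PiE_abs[OF assms(1,3)])
  also have "\<dots> = (\<Prod>i\<in>A. s i)"
    using infsumI[OF assms(2)] by simp
  finally show ?thesis .
qed

section \<open>Weighted compositions and their generating function\<close>

text \<open>A common form of \<open>Omega\<close> (\<open>d j = j\<close>) and
  \<open>compositions\<close> (\<open>d j = 1\<close>), so that one generating function serves
  both.\<close>

definition weighted_compositions :: "nat \<Rightarrow> (nat \<Rightarrow> nat) \<Rightarrow> nat \<Rightarrow> (nat \<Rightarrow> nat) set" where
  "weighted_compositions k d m = {ms \<in> {1..k} \<rightarrow>\<^sub>E UNIV. (\<Sum>j=1..k. d j * ms j) = m}"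

lemma Omega_eq: "Omega k m = weighted_compositions k (\<lambda>j. j) m"
  by (simp add: Omega_def weighted_compositions_def)

lemma compositions_eq: "compositions k m = weighted_compositions k (\<lambda>_. 1) m"
  by (simp add: compositions_def weighted_compositions_def)

lemma finite_weighted_compositions:
  assumes "\<And>j. j \<in> {1..k} \<Longrightarrow> 1 \<le> d j"
  shows "finite (weighted_compositions k d m)"
proof (rule finite_subset)
  show "weighted_compositions k d m \<subseteq> {1..k} \<rightarrow>\<^sub>E {..m}"
  proof
    fix ms assume ms: "ms \<in> weighted_compositions k d m"
    have "ms j \<le> m" if j: "j \<in> {1..k}" for j
    proof -
      have "ms j \<le> d j * ms j" using assms[OF j] by simp
      also have "\<dots> \<le> (\<Sum>j=1..k. d j * ms j)"
        by (rule member_le_sum) (use j in auto)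
      finally show ?thesis using ms by (simp add: weighted_compositions_def)
    qed
    with ms show "ms \<in> {1..k} \<rightarrow>\<^sub>E {..m}"
      by (auto simp: weighted_compositions_def PiE_iff)
  qed
qed (simp add: finite_PiE)

text \<open>Every \<open>ms\<close> has exactly one total weight, so these finite sets partition the
  function space and the series can be summed block by block.\<close>

lemma has_sum_weighted_compositions:
  fixes F :: "(nat \<Rightarrow> nat) \<Rightarrow> real"
  assumes "\<And>j. j \<in> {1..k} \<Longrightarrow> 1 \<le> d j" and "(F has_sum s) ({1..k} \<rightarrow>\<^sub>E UNIV)"
  shows "((\<lambda>m. \<Sum>ms\<in>weighted_compositions k d m. F ms) has_sum s) UNIV"
proof -
  have "snd ` Sigma UNIV (weighted_compositions k d) = {1..k} \<rightarrow>\<^sub>E UNIV"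
    by (force simp: weighted_compositions_def image_iff)
  moreover have "inj_on snd (Sigma UNIV (weighted_compositions k d))"
    by (auto simp: inj_on_def weighted_compositions_def)
  ultimately have "((F \<circ> snd) has_sum s) (Sigma UNIV (weighted_compositions k d))"
    using assms(2) by (simp flip: has_sum_reindex)
  then show ?thesis
    by (rule has_sum_SigmaD) (auto intro!: has_sum_finite finite_weighted_compositions assms(1))
qed

lemma has_sum_exp: "((\<lambda>n. x ^ n / fact n) has_sum exp x) UNIV" for x :: real
  using exp_converges[of x] summable_norm_exp[of x]
  by (intro norm_summable_imp_has_sum) (auto simp: field_simps scaleR_conv_of_real)

lemma abs_summable_exp: "(\<lambda>n. norm (x ^ n / fact n)) summable_on UNIV" for x :: real
  using has_sum_exp[of "\<bar>x\<bar>"] by (auto simp: summable_on_def power_abs)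

text \<open>Each factor \<open>exp (x j * u ^ d j)\<close> is expanded in its own index
  \<open>ms j\<close>; the exponents of \<open>u\<close> add up to the total weight, by which the
  terms are grouped. The signs of \<open>x\<close> and \<open>u\<close> are arbitrary, hence the
  absolute version of the product formula.\<close>

lemma exp_sum_has_sum_weighted_compositions:
  fixes x :: "nat \<Rightarrow> real"
  assumes "\<And>j. j \<in> {1..k} \<Longrightarrow> 1 \<le> d j"
  shows "((\<lambda>m. (\<Sum>ms\<in>weighted_compositions k d m. \<Prod>j=1..k. x j ^ ms j / fact (ms j)) * u ^ m)
    has_sum exp (\<Sum>j=1..k. x j * u ^ d j)) UNIV"
proof -
  have "((\<lambda>ms. \<Prod>j=1..k. (x j * u ^ d j) ^ ms j / fact (ms j)) has_sum
      (\<Prod>j=1..k. exp (x j * u ^ d j))) ({1..k} \<rightarrow>\<^sub>E UNIV)"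
    by (rule has_sum_prod_PiE_abs) (rule has_sum_exp abs_summable_exp finite_atLeastAtMost)+
  then have "((\<lambda>m. \<Sum>ms\<in>weighted_compositions k d m. \<Prod>j=1..k. (x j * u ^ d j) ^ ms j / fact (ms j))
      has_sum (\<Prod>j=1..k. exp (x j * u ^ d j))) UNIV"
    by (intro has_sum_weighted_compositions assms)
  moreover have "(\<Prod>j=1..k. (x j * u ^ d j) ^ ms j / fact (ms j)) =
      (\<Prod>j=1..k. x j ^ ms j / fact (ms j)) * u ^ m" if "ms \<in> weighted_compositions k d m" for ms m
  proof -
    have "(\<Prod>j=1..k. (x j * u ^ d j) ^ ms j / fact (ms j)) =
        (\<Prod>j=1..k. x j ^ ms j / fact (ms j)) * (\<Prod>j=1..k. u ^ (d j * ms j))"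
      by (simp add: prod.distrib[symmetric] power_mult_distrib power_mult)
    also have "(\<Prod>j=1..k. u ^ (d j * ms j)) = u ^ m"
      using that by (simp add: power_sum weighted_compositions_def flip: power_sum)
    finally show ?thesis .
  qed
  ultimately show ?thesis
    by (simp add: exp_sum sum_distrib_right cong: sum.cong)
qed

section \<open>Comparison of power series coefficients\<close>

text \<open>Letting \<open>u\<close> tend to 0 gives \<open>c 0 = 0\<close>; dividing by
  \<open>u\<close> then shifts the coefficients. Excluding \<open>u = 0\<close> from the hypothesis
  makes it stable under this division.\<close>

lemma powser_coeffs_zero:
  fixes c :: "nat \<Rightarrow> real"
  assumes "\<And>u. u \<noteq> 0 \<Longrightarrow> \<bar>u\<bar> < 1 \<Longrightarrow> (\<lambda>n. c n * u ^ n) sums 0"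
  shows "c n = 0"
  using assms
proof (induction n arbitrary: c)
  case 0
  have "((\<lambda>_. 0) \<longlongrightarrow> c 0) (at (0::real))"
    by (rule powser_limit_0_strong[of 1]) (use 0 in auto)
  then show ?case
    by (simp add: tendsto_const_iff)
next
  case (Suc n)
  have "((\<lambda>_. 0) \<longlongrightarrow> c 0) (at (0::real))"
    by (rule powser_limit_0_strong[of 1]) (use Suc.prems in auto)
  then have c0: "c 0 = 0"
    by (simp add: tendsto_const_iff)
  have "(\<lambda>n. c (Suc n) * u ^ n) sums 0" if "u \<noteq> 0" "\<bar>u\<bar> < 1" for u
  proof -
    have "(\<lambda>n. c (Suc n) * u ^ Suc n) sums 0"
      using Suc.prems[OF that] by (subst sums_Suc_iff) (simp add: c0)
    then have "(\<lambda>n. c (Suc n) * u ^ Suc n * inverse u) sums (0 * inverse u)"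
      by (rule sums_mult2)
    then show ?thesis
      using that by (simp add: field_simps)
  qed
  then show ?case
    by (rule Suc.IH[of "\<lambda>n. c (Suc n)"])
qed

lemma powser_coeffs_unique:
  fixes a b :: "nat \<Rightarrow> real"
  assumes "\<And>u. \<bar>u\<bar> < 1 \<Longrightarrow> (\<lambda>n. a n * u ^ n) sums f u"
    and "\<And>u. \<bar>u\<bar> < 1 \<Longrightarrow> (\<lambda>n. b n * u ^ n) sums f u"
  shows "a n = b n"
proof -
  have "a n - b n = 0"
  proof (rule powser_coeffs_zero)
    fix u :: real assume "\<bar>u\<bar> < 1"
    then show "(\<lambda>n. (a n - b n) * u ^ n) sums 0"
      using sums_diff[OF assms(1)[of u] assms(2)[of u]] by (simp add: left_diff_distrib)
  qed
  then show ?thesis by simp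
qed

text \<open>Up to the factor \<open>fact z\<close>, both sides are the coefficient of
  \<open>u ^ z\<close> in the exponential of \<open>u * (\<Sum>j=1..k. x j)\<close>, expanded once
  factor by factor and once as a whole.\<close>

lemma multinomial_compositions:
  fixes x :: "nat \<Rightarrow> real"
  shows "(\<Sum>j=1..k. x j) ^ z = fact z * (\<Sum>r\<in>compositions k z. \<Prod>j=1..k. x j ^ r j / fact (r j))"
proof -
  have "(\<Sum>r\<in>compositions k z. \<Prod>j=1..k. x j ^ r j / fact (r j)) = (\<Sum>j=1..k. x j) ^ z / fact z"
  proof (rule powser_coeffs_unique[where f = "\<lambda>u. exp (\<Sum>j=1..k. x j * u ^ 1)"])
    fix u :: real
    show "(\<lambda>z. (\<Sum>r\<in>compositions k z. \<Prod>j=1..k. x j ^ r j / fact (r j)) * u ^ z)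
        sums exp (\<Sum>j=1..k. x j * u ^ 1)"
      unfolding compositions_eq
      by (intro has_sum_imp_sums exp_sum_has_sum_weighted_compositions) simp
    show "(\<lambda>z. (\<Sum>j=1..k. x j) ^ z / fact z * u ^ z) sums exp (\<Sum>j=1..k. x j * u ^ 1)"
      using has_sum_imp_sums[OF has_sum_exp[of "(\<Sum>j=1..k. x j) * u"]]
      by (simp add: power_mult_distrib flip: sum_distrib_right)
  qed
  then show ?thesis by simp
qed

section \<open>Bell polynomials and tilted Poisson moments\<close>

lemma power_le_fact_exp:
  fixes x :: real
  assumes "0 \<le> x"
  shows "x ^ n \<le> fact n * exp x"
proof -
  have "(\<Sum>i\<in>{n}. x ^ i / fact i) \<le> exp x"
    using assms has_sum_exp[of x] by (intro finite_sum_le_has_sum) auto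
  then show ?thesis
    by (simp add: field_simps)
qed

text \<open>\<open>bell_polynomial\<close> is given by an infinite series, so convergence has to be
  shown; the factor \<open>exp x\<close> cancels its \<open>exp (- x)\<close>.\<close>

lemma has_sum_bell_polynomial:
  assumes "0 \<le> x"
  shows "((\<lambda>i. real i ^ r * x ^ i / fact i) has_sum exp x * bell_polynomial r x) UNIV"
proof -
  \<comment> \<open>\<open>real i ^ r\<close> is at most \<open>fact r * exp (real i)\<close>, and
    \<open>exp (real i)\<close> is absorbed into the power \<open>x ^ i\<close>; hence the argument
    \<open>x * exp 1\<close>.\<close>
  have "summable (\<lambda>i. fact r * ((x * exp 1) ^ i / fact i))"
    by (intro summable_mult sums_summable[OF has_sum_imp_sums[OF has_sum_exp]])
  then have "summable (\<lambda>i. real i ^ r * x ^ i / fact i)"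
  proof (rule summable_comparison_test'[where N = 0])
    fix i
    have "real i ^ r * (x ^ i / fact i) \<le> fact r * exp (real i) * (x ^ i / fact i)"
      by (rule mult_right_mono[OF power_le_fact_exp]) (use assms in auto)
    then show "norm (real i ^ r * x ^ i / fact i) \<le> fact r * ((x * exp 1) ^ i / fact i)"
      using assms by (simp add: power_mult_distrib mult_ac flip: exp_of_nat_mult)
  qed
  moreover have "exp x * bell_polynomial r x = (\<Sum>i. real i ^ r * x ^ i / fact i)"
    by (simp add: bell_polynomial_def exp_minus)
  ultimately show ?thesis
    using assms by (intro norm_summable_imp_has_sum) (auto simp: summable_sums)
qed

lemma has_sum_finite_sum:
  fixes F :: "'i \<Rightarrow> 'b \<Rightarrow> real"
  assumes "finite I" and "\<And>i. i \<in> I \<Longrightarrow> (F i has_sum s i) A"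
  shows "((\<lambda>y. \<Sum>i\<in>I. F i y) has_sum (\<Sum>i\<in>I. s i)) A"
  using assms by (induction I) (auto intro!: has_sum_add)

text \<open>
  After the multinomial expansion of \<open>n ^ z = (\<Sum>j. j * ns j) ^ z\<close>, the sum over all \<open>ns\<close> factorizes
  into one Bell series for each index.
\<close>

lemma sums_Omega_moment:
  fixes x :: "nat \<Rightarrow> real" and l :: real
  assumes "\<And>j. j \<in> {1..k} \<Longrightarrow> 0 \<le> x j"
  shows "(\<lambda>n. (\<Sum>ns\<in>Omega k n. \<Prod>j=1..k. x j ^ ns j / fact (ns j)) * (real n ^ z * exp (- real n * l)))
    sums (\<Sum>r\<in>compositions k z. fact z * (\<Prod>j=1..k. real j ^ r j / fact (r j) *
      exp (x j * exp (- real j * l)) * bell_polynomial (r j) (exp (- real j * l) * x j)))"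
proof -
  \<comment> \<open>Since \<open>n\<close> is the sum of the \<open>j * ns j\<close>, the tilt
    \<open>exp (- real n * l)\<close> splits into one factor \<open>exp (- real j * l)\<close> for
    each unit of \<open>ns j\<close>; so \<open>a j\<close> is the tilted Poisson parameter.\<close>
  define a where "a j = exp (- real j * l) * x j" for j
  \<comment> \<open>The term for \<open>r\<close> in the multinomial expansion of
    \<open>n ^ z\<close>, multiplied by the tilted weight of \<open>ns\<close>.\<close>
  define G where "G ns r = fact z * (\<Prod>j=1..k. real j ^ r j / fact (r j) * (real (ns j) ^ r j * a j ^ ns j / fact (ns j)))"
    for ns r :: "nat \<Rightarrow> nat"
  have a: "0 \<le> a j" if "j \<in> {1..k}" for j
    using assms[OF that] by (simp add: a_def)
  have "((\<lambda>ns. \<Sum>r\<in>compositions k z. G ns r) has_sum (\<Sum>r\<in>compositions k z. fact z *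
      (\<Prod>j=1..k. real j ^ r j / fact (r j) * (exp (a j) * bell_polynomial (r j) (a j))))) ({1..k} \<rightarrow>\<^sub>E UNIV)"
    unfolding G_def using a
    by (intro has_sum_finite_sum has_sum_cmult_right has_sum_prod_PiE_nonneg has_sum_bell_polynomial)
      (auto simp: compositions_eq intro: finite_weighted_compositions)
  \<comment> \<open>Regrouping all \<open>ns\<close> by the value \<open>n\<close> brings back
    \<open>Omega\<close>.\<close>
  then have "((\<lambda>n. \<Sum>ns\<in>Omega k n. \<Sum>r\<in>compositions k z. G ns r) has_sum (\<Sum>r\<in>compositions k z. fact z *
      (\<Prod>j=1..k. real j ^ r j / fact (r j) * (exp (a j) * bell_polynomial (r j) (a j))))) UNIV"
    unfolding Omega_eq by (intro has_sum_weighted_compositions) auto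
  moreover have "(\<Sum>r\<in>compositions k z. G ns r) =
      (\<Prod>j=1..k. x j ^ ns j / fact (ns j)) * (real n ^ z * exp (- real n * l))"
    if ns: "ns \<in> Omega k n" for ns n
  proof -
    have n: "real n = (\<Sum>j=1..k. real j * real (ns j))"
      using ns by (auto simp: Omega_def)
    have "(\<Prod>j=1..k. a j ^ ns j / fact (ns j)) =
        (\<Prod>j=1..k. x j ^ ns j / fact (ns j)) * (\<Prod>j=1..k. exp (- (real j * real (ns j)) * l))"
      unfolding a_def prod.distrib[symmetric]
      by (intro prod.cong) (simp_all add: power_mult_distrib mult_ac flip: exp_of_nat_mult)
    also have "(\<Prod>j=1..k. exp (- (real j * real (ns j)) * l)) = exp (- real n * l)"
      by (simp add: n exp_sum[symmetric] sum_distrib_right sum_negf)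
    finally have A: "(\<Prod>j=1..k. a j ^ ns j / fact (ns j)) =
        (\<Prod>j=1..k. x j ^ ns j / fact (ns j)) * exp (- real n * l)" .
    have "G ns r = fact z * (\<Prod>j=1..k. (real j * real (ns j)) ^ r j / fact (r j)) *
        (\<Prod>j=1..k. a j ^ ns j / fact (ns j))" for r
      unfolding G_def mult.assoc prod.distrib[symmetric]
      by (intro arg_cong[where f = "\<lambda>y. fact z * y"] prod.cong) (simp_all add: power_mult_distrib)
    then have "(\<Sum>r\<in>compositions k z. G ns r) =
        real n ^ z * (\<Prod>j=1..k. a j ^ ns j / fact (ns j))"
      by (simp only: n multinomial_compositions sum_distrib_left sum_distrib_right)
    then show ?thesis
      by (simp only: A mult_ac)
  qed
  then have "(\<lambda>n. \<Sum>ns\<in>Omega k n. \<Sum>r\<in>compositions k z. G ns r) =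
      (\<lambda>n. (\<Sum>ns\<in>Omega k n. \<Prod>j=1..k. x j ^ ns j / fact (ns j)) * (real n ^ z * exp (- real n * l)))"
    unfolding sum_distrib_right by (intro ext sum.cong) auto
  moreover have "real j ^ r j / fact (r j) * (exp (a j) * bell_polynomial (r j) (a j)) =
      real j ^ r j / fact (r j) * exp (x j * exp (- real j * l)) * bell_polynomial (r j) (exp (- real j * l) * x j)"
    for j and r :: "nat \<Rightarrow> nat"
    by (simp add: a_def mult.commute)
  ultimately show ?thesis
    by (intro has_sum_imp_sums) (simp only:)
qed

section \<open>One-dimensional distributions of a generalized counting process\<close>

text \<open>\<open>u ^ N\<close> is split over the values of \<open>N\<close> and integrated
  termwise; the geometric series of \<open>\<bar>u\<bar>\<close> dominates both the terms and their
  integrals, hence the strict bound on \<open>u\<close>.\<close>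

lemma (in prob_space) sums_prob_generating_function:
  fixes N :: "'a \<Rightarrow> nat" and u :: real
  assumes N [measurable]: "N \<in> measurable M (count_space UNIV)" and u: "\<bar>u\<bar> < 1"
  shows "(\<lambda>n. prob {\<omega> \<in> space M. N \<omega> = n} * u ^ n) sums expectation (\<lambda>\<omega>. u ^ N \<omega>)"
proof -
  define f where "f n \<omega> = indicator {\<omega> \<in> space M. N \<omega> = n} \<omega> * u ^ n" for n \<omega>
  have int: "integrable M (f n)" for n
    unfolding f_def by (intro integrable_mult_left integrable_real_indicator) (auto simp: emeasure_eq_measure)
  have sums: "(\<lambda>n. f n \<omega>) sums (u ^ N \<omega>)" if "\<omega> \<in> space M" for \<omega>
  proof -
    have "(\<lambda>n. f n \<omega>) = (\<lambda>n. if n = N \<omega> then u ^ n else 0)"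
      using that by (auto simp: f_def fun_eq_iff)
    then show ?thesis
      using sums_single[of "N \<omega>" "\<lambda>n. u ^ n"] by simp
  qed
  have "summable (\<lambda>n. norm (f n \<omega>))" for \<omega>
    by (rule summable_comparison_test'[OF summable_geometric[of "\<bar>u\<bar>"], of 0])
       (use u in \<open>auto simp: f_def power_abs indicator_def\<close>)
  moreover have "summable (\<lambda>n. \<integral>\<omega>. norm (f n \<omega>) \<partial>M)"
    by (rule summable_comparison_test'[OF summable_geometric[of "\<bar>u\<bar>"], of 0])
       (use u in \<open>auto simp: f_def abs_mult power_abs intro!: mult_left_le_one_le\<close>)
  ultimately have "(\<lambda>n. integral\<^sup>L M (f n)) sums (\<integral>\<omega>. (\<Sum>n. f n \<omega>) \<partial>M)"
    using int by (intro sums_integral) auto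
  moreover have "integral\<^sup>L M (f n) = prob {\<omega> \<in> space M. N \<omega> = n} * u ^ n" for n
    unfolding f_def by simp
  moreover have "(\<integral>\<omega>. (\<Sum>n. f n \<omega>) \<partial>M) = expectation (\<lambda>\<omega>. u ^ N \<omega>)"
    using sums by (intro Bochner_Integration.integral_cong) (auto simp: sums_iff)
  ultimately show ?thesis by simp
qed

text \<open>Two expansions of the probability generating function are compared: one over the values
  of \<open>N s\<close>, the other by splitting off the factor
  \<open>exp (- s * (\<Sum>j=1..k. l j))\<close> and expanding the remaining exponential over
  \<open>Omega\<close>.\<close>

lemma generalized_counting_process_prob:
  assumes "prob_space P" and gcp: "generalized_counting_process P k l N" and s: "0 \<le> s"
  shows "measure P {\<omega> \<in> space P. N s \<omega> = n} =
    exp (- s * (\<Sum>j=1..k. l j)) * (\<Sum>ns\<in>Omega k n. \<Prod>j=1..k. (l j * s) ^ ns j / fact (ns j))"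
proof (rule powser_coeffs_unique)
  interpret prob_space P by fact
  let ?f = "\<lambda>u. exp (- s * (\<Sum>j=1..k. l j * (1 - u ^ j)))"
  fix u :: real assume u: "\<bar>u\<bar> < 1"
  have N: "N s \<in> measurable P (count_space UNIV)"
    and pgf: "expectation (\<lambda>\<omega>. u ^ N s \<omega>) = ?f u"
    using gcp s u by (auto simp: generalized_counting_process_def)
  show "(\<lambda>n. prob {\<omega> \<in> space P. N s \<omega> = n} * u ^ n) sums ?f u"
    using sums_prob_generating_function[OF N u] by (simp add: pgf)
  have "(\<lambda>n. exp (- s * (\<Sum>j=1..k. l j)) * ((\<Sum>ns\<in>Omega k n. \<Prod>j=1..k. (l j * s) ^ ns j / fact (ns j)) * u ^ n))
      sums (exp (- s * (\<Sum>j=1..k. l j)) * exp (\<Sum>j=1..k. l j * s * u ^ j))"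
    unfolding Omega_eq
    by (intro sums_mult has_sum_imp_sums exp_sum_has_sum_weighted_compositions) simp
  moreover have "exp (- s * (\<Sum>j=1..k. l j)) * exp (\<Sum>j=1..k. l j * s * u ^ j) = ?f u"
    by (simp add: algebra_simps sum_subtractf sum_distrib_left sum_negf flip: exp_add)
  ultimately show "(\<lambda>n. exp (- s * (\<Sum>j=1..k. l j)) *
      (\<Sum>ns\<in>Omega k n. \<Prod>j=1..k. (l j * s) ^ ns j / fact (ns j)) * u ^ n) sums ?f u"
    by (simp add: mult.assoc)
qed

text \<open>The generating function at \<open>u = 0\<close>, where \<open>0 ^ 0 = 1\<close> leaves
  just the term \<open>n = 0\<close>.\<close>

lemma generalized_counting_process_prob_0:
  assumes "prob_space P" and gcp: "generalized_counting_process P k l N" and s: "0 \<le> s"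
  shows "measure P {\<omega> \<in> space P. N s \<omega> = 0} = exp (- s * (\<Sum>j=1..k. l j))"
proof -
  interpret prob_space P by fact
  have N: "N s \<in> measurable P (count_space UNIV)"
    and pgf: "expectation (\<lambda>\<omega>. 0 ^ N s \<omega>) = exp (- s * (\<Sum>j=1..k. l j * (1 - 0 ^ j)))"
    using gcp s unfolding generalized_counting_process_def by (blast, force)
  have "(\<lambda>n. prob {\<omega> \<in> space P. N s \<omega> = n} * 0 ^ n) sums prob {\<omega> \<in> space P. N s \<omega> = 0}"
    by (rule powser_sums_zero)
  from sums_unique2[OF this sums_prob_generating_function[OF N]]
  have "prob {\<omega> \<in> space P. N s \<omega> = 0} = exp (- s * (\<Sum>j=1..k. l j * (1 - 0 ^ j)))"
    by (simp add: pgf)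
  \<comment> \<open>Every index \<open>j\<close> is at least 1, so \<open>0 ^ j\<close>
    vanishes.\<close>
  also have "(\<Sum>j=1..k. l j * (1 - 0 ^ j)) = (\<Sum>j=1..k. l j)"
    by (rule sum.cong) auto
  finally show ?thesis .
qed

section \<open>Convolution powers of a distribution function\<close>

text \<open>In the induction \<open>X (Suc m)\<close> is independent of the sum of its predecessors;
  it is placed first, as in the recursion of \<open>convolution_power\<close>.\<close>

lemma (in prob_space) distr_sum_eq_convolution_power:
  fixes X :: "nat \<Rightarrow> 'a \<Rightarrow> real"
  assumes indep: "indep_vars (\<lambda>_. borel) X {1..}" and D: "\<And>i. 1 \<le> i \<Longrightarrow> distr M borel (X i) = D"
  shows "distr M borel (\<lambda>\<omega>. \<Sum>i=1..m. X i \<omega>) = convolution_power m D"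
proof (induction m)
  case 0
  show ?case
    by (auto intro!: measure_eqI simp: emeasure_distr emeasure_space_1 indicator_def)
next
  case (Suc m)
  have X: "X i \<in> borel_measurable M" if "1 \<le> i" for i
    using indep that by (auto simp: indep_vars_def)
  have "indep_var borel (X (Suc m)) borel (\<lambda>\<omega>. \<Sum>i=1..m. X i \<omega>)"
    by (rule indep_vars_sum) (auto intro: indep_vars_subset[OF indep])
  then have "distr M borel (\<lambda>\<omega>. X (Suc m) \<omega> + (\<Sum>i=1..m. X i \<omega>)) =
      (distr M borel (X (Suc m)) \<star> distr M borel (\<lambda>\<omega>. \<Sum>i=1..m. X i \<omega>))"
    by (rule sum_indep_random_variable) (auto intro!: X borel_measurable_sum)
  then show ?case
    using Suc.IH by (simp add: D add.commute)
qed

text \<open>\<open>cdf_convolution_power\<close> starts from the function \<open>H\<close>, so the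
  law of the variables must be recovered from it; a real distribution is determined by its
  distribution function.\<close>

lemma (in prob_space) interval_measure_cdf_distr:
  assumes "X \<in> borel_measurable M"
  shows "interval_measure (cdf (distr M borel X)) = distr M borel X"
proof (rule cdf_unique)
  show D: "real_distribution (distr M borel X)"
    using assms by (rule real_distribution_distr)
  interpret D: real_distribution "distr M borel X"
    by (rule D)
  show "real_distribution (interval_measure (cdf (distr M borel X)))"
    by (rule real_distribution_interval_measure)
       (auto intro: D.cdf_nondecreasing D.cdf_is_right_cont D.cdf_lim_at_bot D.cdf_lim_at_top_prob)
  show "cdf (interval_measure (cdf (distr M borel X))) = cdf (distr M borel X)"
    by (rule cdf_interval_measure)
       (auto intro: D.cdf_nondecreasing D.cdf_is_right_cont D.cdf_lim_at_bot)
qed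

lemma iid_with_cdf_prob_sum_le:
  assumes "prob_space P" and iid: "iid_with_cdf P X H"
  shows "measure P {\<omega> \<in> space P. (\<Sum>i=1..m. X i \<omega>) \<le> w} = cdf_convolution_power m H w"
proof -
  interpret prob_space P by fact
  have indep: "indep_vars (\<lambda>_. borel) X {1..}"
    using iid by (simp add: iid_with_cdf_def)
  have H: "cdf (distr P borel (X i)) = H" if "1 \<le> i" for i
    using iid that by (simp add: iid_with_cdf_def)
  have X: "X i \<in> borel_measurable P" if "1 \<le> i" for i
    using indep that by (auto simp: indep_vars_def)
  have "distr P borel (X i) = interval_measure H" if "1 \<le> i" for i
    using interval_measure_cdf_distr[OF X[OF that]] H[OF that] by simp
  from distr_sum_eq_convolution_power[OF indep this]
  have "cdf_convolution_power m H w = measure (distr P borel (\<lambda>\<omega>. \<Sum>i=1..m. X i \<omega>)) {..w}"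
    by (simp add: cdf_convolution_power_def cdf_def)
  also have "\<dots> = prob {\<omega> \<in> space P. (\<Sum>i=1..m. X i \<omega>) \<le> w}"
    by (subst measure_distr) (auto intro!: borel_measurable_sum X arg_cong[where f = prob])
  finally show ?thesis by simp
qed

section \<open>The iterated process\<close>

lemma process_space_component_measurable:
  "0 \<le> s \<Longrightarrow> (\<lambda>f. f s) \<in> measurable process_space (count_space UNIV)"
  unfolding process_space_def by (rule measurable_component_singleton) simp

text \<open>On the event \<open>M0 t = n\<close> the random time is the constant \<open>n\<close>,
  and independence of the whole paths passes to the coordinates \<open>M0 t\<close> and
  \<open>M (real n)\<close>.\<close>

lemma iterated_process_prob_sums:
  fixes M0 M :: "real \<Rightarrow> 'a \<Rightarrow> nat"
  assumes "prob_space P" and t: "0 \<le> t"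
    and indep: "prob_space.indep_var P process_space (whole_path M0) process_space (whole_path M)"
  shows "(\<lambda>n. measure P {\<omega> \<in> space P. M0 t \<omega> = n} * measure P {\<omega> \<in> space P. M (real n) \<omega> = m})
    sums measure P {\<omega> \<in> space P. M (real (M0 t \<omega>)) \<omega> = m}"
proof -
  interpret prob_space P by fact
  define A where "A n = {\<omega> \<in> space P. M0 t \<omega> = n \<and> M (real n) \<omega> = m}" for n
  have ind: "indep_var (count_space UNIV) (\<lambda>\<omega>. M0 t \<omega>) (count_space UNIV) (\<lambda>\<omega>. M (real n) \<omega>)" for n
    using indep_var_compose[OF indep process_space_component_measurable[OF t]
        process_space_component_measurable[of "real n"]] t
    by (simp add: comp_def whole_path_def)
  have [measurable]: "M0 t \<in> measurable P (count_space UNIV)"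
      "M (real n) \<in> measurable P (count_space UNIV)" for n
    using indep_var_rv1[OF ind] indep_var_rv2[OF ind] by auto
  have "prob (A n) = prob {\<omega> \<in> space P. M0 t \<omega> = n} * prob {\<omega> \<in> space P. M (real n) \<omega> = m}" for n
    using indep_varD[OF ind, of "{n}" "{m}" n]
    by (simp add: A_def vimage_def Int_def conj_commute conj_left_commute)
  moreover have "(\<lambda>n. prob (A n)) sums prob (\<Union>n. A n)"
    by (rule finite_measure_UNION) (auto simp: A_def disjoint_family_on_def)
  moreover have "(\<Union>n. A n) = {\<omega> \<in> space P. M (real (M0 t \<omega>)) \<omega> = m}"
    by (auto simp: A_def)
  ultimately show ?thesis by simp
qed

text \<open>At the fixed time \<open>n\<close> the probability is a finite sum over
  \<open>Omega k m\<close> of multiples of \<open>real n ^ z * exp (- real n * lams)\<close>;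
  averaging over the law of \<open>M0 t\<close> turns these into the tilted moments of
  \<open>sums_Omega_moment\<close>.\<close>

lemma iterated_gcp_prob:
  assumes "prob_space P"
    and gcp0: "generalized_counting_process P k0 mu M0" and gcp: "generalized_counting_process P k lam M"
    and indep: "prob_space.indep_var P process_space (whole_path M0) process_space (whole_path M)"
    and lams: "lams = (\<Sum>j=1..k. lam j)" and mus: "mus = (\<Sum>j=1..k0. mu j)" and t: "0 \<le> t"
  shows "measure P {\<omega> \<in> space P. M (real (M0 t \<omega>)) \<omega> = m} =
    (\<Sum>ms\<in>Omega k m. let z = (\<Sum>j=1..k. ms j) in
       (\<Prod>j=1..k. lam j ^ ms j / fact (ms j)) * exp (- mus * t) *
       (\<Sum>r\<in>compositions k0 z. fact z * (\<Prod>j=1..k0. real j ^ r j / fact (r j) *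
          exp (mu j * t * exp (- real j * lams)) *
          bell_polynomial (r j) (exp (- real j * lams) * mu j * t))))"
proof (rule sums_unique2[OF iterated_process_prob_sums[OF assms(1) t indep]])
  define B where "B z = (\<Sum>r\<in>compositions k0 z. fact z * (\<Prod>j=1..k0. real j ^ r j / fact (r j) *
      exp (mu j * t * exp (- real j * lams)) * bell_polynomial (r j) (exp (- real j * lams) * (mu j * t))))"
    for z
  define p where "p n = (\<Sum>ns\<in>Omega k0 n. \<Prod>j=1..k0. (mu j * t) ^ ns j / fact (ns j))" for n
  define L where "L ms = (\<Prod>j=1..k. lam j ^ ms j / fact (ms j))" for ms :: "nat \<Rightarrow> nat"
  define z where "z ms = (\<Sum>j=1..k. ms j)" for ms :: "nat \<Rightarrow> nat"
  have mu: "0 \<le> mu j * t" if "j \<in> {1..k0}" for j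
    by (rule mult_nonneg_nonneg[OF less_imp_le t])
       (use gcp0 that in \<open>simp add: generalized_counting_process_def\<close>)
  have "(\<lambda>n. p n * (real n ^ z * exp (- real n * lams))) sums B z" for z
    unfolding p_def B_def by (rule sums_Omega_moment) (rule mu)
  then have "(\<lambda>n. \<Sum>ms\<in>Omega k m. L ms * exp (- mus * t) * (p n * (real n ^ z ms * exp (- real n * lams)))) sums
      (\<Sum>ms\<in>Omega k m. L ms * exp (- mus * t) * B (z ms))"
    by (intro sums_sum sums_mult)
  moreover have "measure P {\<omega> \<in> space P. M0 t \<omega> = n} * measure P {\<omega> \<in> space P. M (real n) \<omega> = m} =
      (\<Sum>ms\<in>Omega k m. L ms * exp (- mus * t) * (p n * (real n ^ z ms * exp (- real n * lams))))" for n
  proof -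
    \<comment> \<open>The time comes out of the product with the total exponent \<open>z ms\<close>.
      At \<open>n = 0\<close> the convention \<open>0 ^ 0 = 1\<close> keeps the whole mass at
      \<open>m = 0\<close>.\<close>
    have "(\<Prod>j=1..k. (lam j * real n) ^ ms j / fact (ms j)) = L ms * real n ^ z ms" for ms
      by (simp add: L_def z_def power_sum power_mult_distrib flip: prod.distrib)
    then have "measure P {\<omega> \<in> space P. M (real n) \<omega> = m} =
        exp (- real n * lams) * (\<Sum>ms\<in>Omega k m. L ms * real n ^ z ms)"
      by (simp add: generalized_counting_process_prob[OF assms(1) gcp] lams)
    moreover have "measure P {\<omega> \<in> space P. M0 t \<omega> = n} = exp (- mus * t) * p n"
      by (simp add: generalized_counting_process_prob[OF assms(1) gcp0 t] mus p_def mult.commute)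
    ultimately show ?thesis
      by (simp add: sum_distrib_left mult_ac)
  qed
  ultimately show "(\<lambda>n. measure P {\<omega> \<in> space P. M0 t \<omega> = n} * measure P {\<omega> \<in> space P. M (real n) \<omega> = m}) sums
    (\<Sum>ms\<in>Omega k m. let z = (\<Sum>j=1..k. ms j) in
       (\<Prod>j=1..k. lam j ^ ms j / fact (ms j)) * exp (- mus * t) *
       (\<Sum>r\<in>compositions k0 z. fact z * (\<Prod>j=1..k0. real j ^ r j / fact (r j) *
          exp (mu j * t * exp (- real j * lams)) *
          bell_polynomial (r j) (exp (- real j * lams) * mu j * t))))"
    by (simp only: L_def z_def B_def Let_def mult.assoc)
qed

text \<open>\<open>M (real n)\<close> is 0 with probability \<open>exp (- lams) ^ n\<close>, so
  averaging over \<open>n\<close> evaluates the generating function of \<open>M0 t\<close> at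
  \<open>exp (- lams)\<close>.\<close>

lemma iterated_gcp_prob_0:
  assumes "prob_space P"
    and gcp0: "generalized_counting_process P k0 mu M0" and gcp: "generalized_counting_process P k lam M"
    and indep: "prob_space.indep_var P process_space (whole_path M0) process_space (whole_path M)"
    and lams: "lams = (\<Sum>j=1..k. lam j)" and t: "0 \<le> t"
  shows "measure P {\<omega> \<in> space P. M (real (M0 t \<omega>)) \<omega> = 0} =
    exp (- (\<Sum>j=1..k0. mu j * t * (1 - exp (- real j * lams))))"
proof (rule sums_unique2[OF iterated_process_prob_sums[OF assms(1) t indep]])
  interpret prob_space P by fact
  \<comment> \<open>A nonempty sum of positive rates; it places \<open>exp (- lams)\<close> strictly
    inside the unit disc.\<close>
  have "0 < lams"
    unfolding lams using gcp by (intro sum_pos) (auto simp: generalized_counting_process_def)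
  then have u: "\<bar>exp (- lams)\<bar> < 1" by simp
  have N: "M0 t \<in> measurable P (count_space UNIV)"
    and pgf: "expectation (\<lambda>\<omega>. exp (- lams) ^ M0 t \<omega>) = exp (- t * (\<Sum>j=1..k0. mu j * (1 - exp (- lams) ^ j)))"
    using gcp0 t u by (auto simp: generalized_counting_process_def)
  have "(\<lambda>n. prob {\<omega> \<in> space P. M0 t \<omega> = n} * exp (- real n * lams)) sums
      exp (- t * (\<Sum>j=1..k0. mu j * (1 - exp (- lams) ^ j)))"
    using sums_prob_generating_function[OF N u] unfolding pgf by (simp flip: exp_of_nat_mult)
  moreover have "prob {\<omega> \<in> space P. M (real n) \<omega> = 0} = exp (- real n * lams)" for n
    by (simp add: generalized_counting_process_prob_0[OF assms(1) gcp] lams)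
  moreover have "- t * (\<Sum>j=1..k0. mu j * (1 - exp (- lams) ^ j)) =
      - (\<Sum>j=1..k0. mu j * t * (1 - exp (- real j * lams)))"
    by (simp add: sum_distrib_left sum_negf mult_ac flip: exp_of_nat_mult)
  ultimately show "(\<lambda>n. prob {\<omega> \<in> space P. M0 t \<omega> = n} * prob {\<omega> \<in> space P. M (real n) \<omega> = 0}) sums
      exp (- (\<Sum>j=1..k0. mu j * t * (1 - exp (- real j * lams))))"
    by simp
qed

section \<open>The compound process\<close>

text \<open>Where the iterated process equals \<open>m\<close>, the compound sum has exactly
  \<open>m\<close> summands. The event \<open>C m\<close> is determined by the sequence
  \<open>X\<close> and \<open>B m\<close> by the pair of paths, so their probabilities
  multiply.\<close>

lemma compound_igcp_cdf_sums:
  assumes "prob_space P" and iid: "iid_with_cdf P X H" and t: "0 \<le> t"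
    and "prob_space.indep_var P process_space (whole_path M0) process_space (whole_path M)"
    and indep: "prob_space.indep_set P
           (sets (vimage_algebra (space P) (\<lambda>\<omega>. \<lambda>i\<in>{1..}. X i \<omega>) (\<Pi>\<^sub>M i\<in>{1..}. borel)))
           (sets (vimage_algebra (space P) (\<lambda>\<omega>. (whole_path M0 \<omega>, whole_path M \<omega>))
              (process_space \<Otimes>\<^sub>M process_space)))"
  shows "(\<lambda>m. cdf_convolution_power m H w * measure P {\<omega> \<in> space P. M (real (M0 t \<omega>)) \<omega> = m})
    sums measure P {\<omega> \<in> space P. compound_igcp M0 M X t \<omega> \<le> w}"
proof -
  interpret prob_space P by fact
  let ?V = "vimage_algebra (space P) (\<lambda>\<omega>. \<lambda>i\<in>{1..}. X i \<omega>) (\<Pi>\<^sub>M i\<in>{1..}. borel)"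
  let ?W = "vimage_algebra (space P) (\<lambda>\<omega>. (whole_path M0 \<omega>, whole_path M \<omega>)) (process_space \<Otimes>\<^sub>M process_space)"
  define C where "C m = {\<omega> \<in> space P. (\<Sum>i=1..m. X i \<omega>) \<le> w}" for m
  define B where "B m = {\<omega> \<in> space P. M (real (M0 t \<omega>)) \<omega> = m}" for m
  have C: "C m \<in> sets ?V" for m
  proof -
    have "{x \<in> space (\<Pi>\<^sub>M i\<in>{1..}. borel). (\<Sum>i=1..m. x i) \<le> w} \<in> sets (\<Pi>\<^sub>M i\<in>{1..}. (borel :: real measure))"
      by measurable
    from in_vimage_algebra[OF this, of "\<lambda>\<omega>. \<lambda>i\<in>{1..}. X i \<omega>" "space P"] show ?thesis
      by (rule back_subst[where P = "\<lambda>S. S \<in> sets ?V"]) (auto simp: C_def space_PiM)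
  qed
  have B: "B m \<in> sets ?W" for m
  proof -
    let ?S = "process_space \<Otimes>\<^sub>M process_space"
    have [measurable]: "(\<lambda>f. f t) \<in> measurable process_space (count_space UNIV)"
        "(\<lambda>f. f (real n)) \<in> measurable process_space (count_space UNIV)" for n
      using t by (auto intro: process_space_component_measurable)
    \<comment> \<open>The random time takes countably many values, so a union over \<open>n\<close>
      reduces evaluation at that time to evaluations at fixed times.\<close>
    have "(\<Union>n. {x \<in> space ?S. fst x t = n \<and> snd x (real n) = m}) \<in> sets ?S"
      by measurable
    from in_vimage_algebra[OF this, of "\<lambda>\<omega>. (whole_path M0 \<omega>, whole_path M \<omega>)" "space P"] show ?thesis
      by (rule back_subst[where P = "\<lambda>S. S \<in> sets ?W"])
         (use t in \<open>auto simp: B_def space_pair_measure process_space_def space_PiM whole_path_def\<close>)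
  qed
  have "C m \<inter> B m \<in> events" for m
    using subsetD[OF indep_setD_ev1[OF indep] C] subsetD[OF indep_setD_ev2[OF indep] B]
    by (rule sets.Int)
  then have "(\<lambda>m. prob (C m \<inter> B m)) sums prob (\<Union>m. C m \<inter> B m)"
    by (intro finite_measure_UNION) (auto simp: B_def disjoint_family_on_def)
  moreover have "prob (C m \<inter> B m) = cdf_convolution_power m H w * prob (B m)" for m
    using indep_setD[OF indep C B] iid_with_cdf_prob_sum_le[OF assms(1) iid] by (simp add: C_def)
  moreover have "(\<Union>m. C m \<inter> B m) = {\<omega> \<in> space P. compound_igcp M0 M X t \<omega> \<le> w}"
    by (auto simp: B_def C_def compound_igcp_def)
  ultimately show ?thesis
    by (simp add: B_def)
qed

theorem proposition4p1:
  fixes P :: "'a measure"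
    and M0 M :: "real \<Rightarrow> 'a \<Rightarrow> nat"
    and X :: "nat \<Rightarrow> 'a \<Rightarrow> real"
    and H :: "real \<Rightarrow> real"
    and k0 k :: nat
    and mu lam :: "nat \<Rightarrow> real"
    and mus lams w t :: real
  assumes "prob_space P"
    and "generalized_counting_process P k0 mu M0"
    and "generalized_counting_process P k lam M"
    and "prob_space.indep_var P process_space (whole_path M0) process_space (whole_path M)"
    and "iid_with_cdf P X H"
    and "prob_space.indep_set P
           (sets (vimage_algebra (space P) (\<lambda>\<omega>. \<lambda>i\<in>{1..}. X i \<omega>) (\<Pi>\<^sub>M i\<in>{1..}. borel)))
           (sets (vimage_algebra (space P) (\<lambda>\<omega>. (whole_path M0 \<omega>, whole_path M \<omega>))
              (process_space \<Otimes>\<^sub>M process_space)))"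
    and "lams = (\<Sum>j=1..k. lam j)"
    and "mus = (\<Sum>j0=1..k0. mu j0)"
    and "0 \<le> t"
  defines "S \<equiv> (\<lambda>m::nat. cdf_convolution_power m H w *
      (\<Sum>ms\<in>Omega k m.
         let z = (\<Sum>j=1..k. ms j) in
         (\<Prod>j=1..k. lam j ^ ms j / fact (ms j)) * exp (- mus * t) *
         (\<Sum>r\<in>compositions k0 z.
            fact z * (\<Prod>j0=1..k0.
              real j0 ^ r j0 / fact (r j0) *
              exp (mu j0 * t * exp (- real j0 * lams)) *
              bell_polynomial (r j0) (exp (- real j0 * lams) * mu j0 * t)))))"
  shows "summable (\<lambda>m. S (Suc m)) \<and>
    measure P {\<omega> \<in> space P. compound_igcp M0 M X t \<omega> \<le> w} =
      (if 0 \<le> w then 1 else 0) * exp (- (\<Sum>j0=1..k0. mu j0 * t * (1 - exp (- real j0 * lams))))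
      + (\<Sum>m. S (Suc m))"
proof -
  \<comment> \<open>\<open>S\<close> is meaningful at 0 as well, so the series is summed from 0 and
    its first term is split off at the end.\<close>
  have "S = (\<lambda>m. cdf_convolution_power m H w * measure P {\<omega> \<in> space P. M (real (M0 t \<omega>)) \<omega> = m})"
    unfolding S_def by (simp only: iterated_gcp_prob[OF assms(1-4,7-9)])
  with compound_igcp_cdf_sums[OF assms(1,5,9,4,6)]
  have S: "S sums measure P {\<omega> \<in> space P. compound_igcp M0 M X t \<omega> \<le> w}"
    and S0: "S 0 = cdf_convolution_power 0 H w * measure P {\<omega> \<in> space P. M (real (M0 t \<omega>)) \<omega> = 0}"
    by simp_all
  \<comment> \<open>The empty convolution is the point mass at 0, the source of the
    indicator.\<close>
  have "cdf_convolution_power 0 H w = (if 0 \<le> w then 1 else 0)"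
    by (simp add: cdf_convolution_power_def cdf_def measure_return)
  \<comment> \<open>The first term takes its closed form from the generating function instead of its
    expansion in Bell polynomials.\<close>
  then have "S 0 = (if 0 \<le> w then 1 else 0) * exp (- (\<Sum>j0=1..k0. mu j0 * t * (1 - exp (- real j0 * lams))))"
    by (simp only: S0 iterated_gcp_prob_0[OF assms(1-4,7,9)])
  with S show ?thesis
    by (simp add: sums_iff suminf_split_head summable_Suc_iff)
qed

end
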